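(* Let $T:S^1\to S^1$ be an expanding map, i.e. $T\in C^2$ and $|T'(x)|>1$ for all $x\in S^1$, with transfer operator $L$, and let $\alpha=\max_{x}\frac{1}{|T'(x)|}$. Let $g_n=\frac1n\sum_{i=0}^{n-1}L^i1$ and let $h$ be an invariant density of $L$ obtained as the limit in $L^1$ of a subsequence $g_{n_k}$. Then $h\in W^{1,1}$ and $$\|h\|_{W^{1,1}}\le \frac{\left\|\frac{T''}{(T')^2}\right\|_\infty+1}{1-\alpha}.$$
   Context: $S^1=\mathbb R/\mathbb Z$ with normalized Lebesgue measure $m$; $1$ denotes the constant density. The transfer operator acts on $L^1(m)$ by $[Lf](x)=\sum_{y\in T^{-1}(x)}\frac{f(y)}{|T'(y)|}$. $W^{1,1}$ is the Banach space of absolutely continuous functions on $S^1$ with norm $\|f\|_{W^{1,1}}=\|f\|_1+\|f'\|_1$. *)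

theory Defs
  imports "HOL-Analysis.Analysis"
begin

text \<open>The circle \<open>\<real>/\<int>\<close>; \<open>to_circle\<close> is the canonical projection from the reals.\<close>

quotient_type circle = real / "\<lambda>s t :: real. s - t \<in> \<int>"
  morphisms from_circle to_circle
proof (rule equivpI)
  show "reflp (\<lambda>s t :: real. s - t \<in> \<int>)"
    by (auto intro: reflpI)
  show "symp (\<lambda>s t :: real. s - t \<in> \<int>)"
    by (rule sympI) (use Ints_minus in fastforce)
  show "transp (\<lambda>s t :: real. s - t \<in> \<int>)"
  proof (rule transpI)
    fix s t u :: real
    assume "s - t \<in> \<int>" "t - u \<in> \<int>"
    then have "(s - t) + (t - u) \<in> \<int>"
      by (rule Ints_add)
    then show "s - u \<in> \<int>"
      by simp
  qed
qed

lemma to_circle_eq_iff: "to_circle s = to_circle t \<longleftrightarrow> s - t \<in> \<int>"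
  by (rule circle.abs_eq_iff)

lemma surj_to_circle: "\<exists>t. to_circle t = x"
  by (metis Quotient3_circle Quotient3_abs_rep)

instantiation circle :: topological_space
begin

definition open_circle :: "circle set \<Rightarrow> bool" where
  "open_circle U \<longleftrightarrow> open (to_circle -` U)"

instance
  by standard (auto simp: open_circle_def vimage_Union)

end

text \<open>Normalized Lebesgue measure on the Borel sets of the circle.\<close>

definition circle_measure :: "circle measure" where
  "circle_measure = distr (restrict_space lborel {0..<1}) borel to_circle"

lemma continuous_to_circle: "continuous_on UNIV to_circle"
  by (auto simp: continuous_on_open_vimage open_circle_def)

lemma prob_space_circle_measure:
  "finite_measure circle_measure" "emeasure circle_measure UNIV = 1"
proof -
  have m: "to_circle \<in> measurable (restrict_space lborel {0..<1}) borel"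
    by (intro measurable_restrict_space1) 
       (simp add: borel_measurable_continuous_onI continuous_to_circle)
  show *: "emeasure circle_measure UNIV = 1"
    unfolding circle_measure_def
    by (subst emeasure_distr[OF m]) (auto simp: emeasure_restrict_space space_restrict_space)
  then show "finite_measure circle_measure"
    by (intro finite_measureI) (simp add: circle_measure_def)
qed

text \<open>
  Derivatives are taken in the charts given by local inverses of \<open>to_circle\<close>: a map of the
  circle is differentiated through a local lift to the reals, a real-valued function through
  its pullback to the reals.
\<close>

definition has_circle_deriv :: "(circle \<Rightarrow> circle) \<Rightarrow> real \<Rightarrow> circle \<Rightarrow> bool" where
  "has_circle_deriv T D x \<longleftrightarrow>
     (\<exists>t F. to_circle t = x \<and> (\<forall>\<^sub>F s in nhds t. T (to_circle s) = to_circle (F s)) \<and>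
            (F has_real_derivative D) (at t))"

definition circle_deriv :: "(circle \<Rightarrow> circle) \<Rightarrow> circle \<Rightarrow> real" where
  "circle_deriv T x = (THE D. has_circle_deriv T D x)"

definition has_fun_deriv :: "(circle \<Rightarrow> real) \<Rightarrow> real \<Rightarrow> circle \<Rightarrow> bool" where
  "has_fun_deriv f D x \<longleftrightarrow>
     (\<exists>t. to_circle t = x \<and> ((\<lambda>s. f (to_circle s)) has_real_derivative D) (at t))"

definition fun_deriv :: "(circle \<Rightarrow> real) \<Rightarrow> circle \<Rightarrow> real" where
  "fun_deriv f x = (THE D. has_fun_deriv f D x)"

lemma has_circle_deriv_unique:
  assumes "has_circle_deriv T D x" "has_circle_deriv T E x"
  shows "D = E"
proof -
  obtain t F where t: "to_circle t = x" 
    and F: "\<forall>\<^sub>F s in nhds t. T (to_circle s) = to_circle (F s)" "(F has_real_derivative D) (at t)"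
    using assms(1) unfolding has_circle_deriv_def by blast
  obtain u G where u: "to_circle u = x" 
    and G: "\<forall>\<^sub>F s in nhds u. T (to_circle s) = to_circle (G s)" "(G has_real_derivative E) (at u)"
    using assms(2) unfolding has_circle_deriv_def by blast
  define k where "k = u - t"
  have k: "k \<in> \<int>"
    using t u unfolding k_def by (simp flip: to_circle_eq_iff)
  define H where "H = (\<lambda>s. F s - G (s + k))"
  have "((\<lambda>s. G (s + k)) has_real_derivative E) (at t)"
    using G(2) DERIV_shift[of G E t k] by (simp add: k_def)
  then have H: "(H has_real_derivative D - E) (at t)"
    unfolding H_def by (intro DERIV_diff F)
  have "filterlim (\<lambda>s. s + k) (nhds u) (nhds t)"
    unfolding k_def by (auto intro!: tendsto_eq_intros filterlim_ident)
  then have "\<forall>\<^sub>F s in nhds t. T (to_circle (s + k)) = to_circle (G (s + k))"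
    using G(1) by (rule eventually_compose_filterlim[rotated])
  then have Z: "\<forall>\<^sub>F s in nhds t. H s \<in> \<int>"
    using F(1)
  proof eventually_elim
    case (elim s)
    have "to_circle (s + k) = to_circle s"
      using k by (simp add: to_circle_eq_iff)
    with elim show ?case
      by (simp add: H_def flip: to_circle_eq_iff)
  qed
  then have Ht: "H t \<in> \<int>"
    by (rule eventually_nhds_x_imp_x)
  have "isCont H t"
    using H by (rule DERIV_isCont)
  then have "(H \<longlongrightarrow> H t) (nhds t)"
    by (simp only: isCont_def tendsto_at_iff_tendsto_nhds)
  then have "\<forall>\<^sub>F s in nhds t. dist (H s) (H t) < 1"
    by (rule tendstoD) simp
  with Z have "\<forall>\<^sub>F s in nhds t. H s = H t"
  proof eventually_elim
    case (elim s)
    from elim(1) Ht obtain m n where "H s = of_int m" "H t = of_int n"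
      by (auto elim!: Ints_cases)
    with elim(2) show ?case
      by (simp add: dist_real_def flip: of_int_diff)
  qed
  then have "(H has_real_derivative 0) (at t)"
    using DERIV_cong_ev[of t t H "\<lambda>_. H t" 0 0] by simp
  then show ?thesis
    using DERIV_unique[OF H, of 0] by simp
qed

lemma has_fun_deriv_unique:
  assumes "has_fun_deriv f D x" "has_fun_deriv f E x"
  shows "D = E"
proof -
  obtain t u where t: "to_circle t = x" "((\<lambda>s. f (to_circle s)) has_real_derivative D) (at t)"
    and u: "to_circle u = x" "((\<lambda>s. f (to_circle s)) has_real_derivative E) (at u)"
    using assms unfolding has_fun_deriv_def by blast
  have "u - t \<in> \<int>"
    using t(1) u(1) by (simp flip: to_circle_eq_iff)
  then have "to_circle (s + (u - t)) = to_circle s" for s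
    by (simp add: to_circle_eq_iff)
  then have "((\<lambda>s. f (to_circle s)) has_real_derivative E) (at t)"
    using u(2) DERIV_shift[of "\<lambda>s. f (to_circle s)" E t "u - t"] by simp
  then show ?thesis
    using t(2) DERIV_unique by blast
qed

definition C2_circle_map :: "(circle \<Rightarrow> circle) \<Rightarrow> bool" where
  "C2_circle_map T \<longleftrightarrow>
     (\<forall>x. \<exists>D. has_circle_deriv T D x) \<and>
     (\<forall>x. \<exists>D. has_fun_deriv (circle_deriv T) D x) \<and>
     continuous_on UNIV (fun_deriv (circle_deriv T))"

definition expanding_map :: "(circle \<Rightarrow> circle) \<Rightarrow> bool" where
  "expanding_map T \<longleftrightarrow> C2_circle_map T \<and> (\<forall>x. \<bar>circle_deriv T x\<bar> > 1)"

text \<open>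
  For an expanding map all preimages of points are finite, so the sum below is never the
  default value of a sum over an infinite set.
\<close>

definition transfer_op :: "(circle \<Rightarrow> circle) \<Rightarrow> (circle \<Rightarrow> real) \<Rightarrow> circle \<Rightarrow> real" where
  "transfer_op T f x = (\<Sum>y\<in>T -` {x}. f y / \<bar>circle_deriv T y\<bar>)"

definition cesaro_density :: "(circle \<Rightarrow> circle) \<Rightarrow> nat \<Rightarrow> circle \<Rightarrow> real" where
  "cesaro_density T n x = (\<Sum>i<n. (transfer_op T ^^ i) (\<lambda>_. 1) x) / real n"

text \<open>
  Elements of \<open>L\<^sup>1\<close> are represented by integrable functions, so identities between them hold
  almost everywhere.
\<close>

definition L1_norm :: "(circle \<Rightarrow> real) \<Rightarrow> real" where
  "L1_norm f = (\<integral>x. \<bar>f x\<bar> \<partial>circle_measure)"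

definition invariant_density :: "(circle \<Rightarrow> circle) \<Rightarrow> (circle \<Rightarrow> real) \<Rightarrow> bool" where
  "invariant_density T h \<longleftrightarrow>
     integrable circle_measure h \<and>
     (AE x in circle_measure. h x \<ge> 0) \<and>
     (\<integral>x. h x \<partial>circle_measure) = 1 \<and>
     (AE x in circle_measure. transfer_op T h x = h x)"

text \<open>
  Absolute continuity on the circle, read off on the fundamental domain \<open>[0,1]\<close>; an arc
  through \<open>to_circle 0\<close> is split there into two. Membership of an \<open>L\<^sup>1\<close> class in \<open>W\<^sup>1\<^sup>,\<^sup>1\<close> means
  that it has a representative in the set \<open>W11\<close>. An absolutely continuous function is
  differentiable almost everywhere with integrable derivative, so both integrals in
  \<open>W11_norm\<close> are then proper ones.
\<close>

definition W11 :: "(circle \<Rightarrow> real) set" where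
  "W11 = {f. \<forall>\<epsilon>>0. \<exists>\<delta>>0. \<forall>(n :: nat) a b.
     (\<forall>i<n. 0 \<le> a i \<and> a i \<le> b i \<and> b i \<le> 1) \<longrightarrow>
     disjoint_family_on (\<lambda>i. {a i<..<b i}) {..<n} \<longrightarrow>
     (\<Sum>i<n. b i - a i) < \<delta> \<longrightarrow>
     (\<Sum>i<n. \<bar>f (to_circle (b i)) - f (to_circle (a i))\<bar>) < (\<epsilon> :: real)}"

definition W11_norm :: "(circle \<Rightarrow> real) \<Rightarrow> real" where
  "W11_norm f = L1_norm f + L1_norm (fun_deriv f)"

text \<open>
  The supremum norm; for continuous functions it agrees with the essential supremum, since
  nonempty open sets have positive measure.
\<close>

definition sup_norm :: "(circle \<Rightarrow> real) \<Rightarrow> real" where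
  "sup_norm f = (SUP x. \<bar>f x\<bar>)"

end

theory Submission
  imports Defs
begin

text \<open>
  Write \<open>\<Delta>\<close> for the supremum of \<open>\<bar>T''\<bar> / (T')\<^sup>2\<close>. Let \<open>f\<close> be positive with \<open>\<bar>f'\<bar> \<le> C * f\<close>, that is,
  with \<open>log f\<close> Lipschitz with constant \<open>C\<close>. The function \<open>L f\<close> is a sum of terms \<open>f (G x) * \<bar>G' x\<bar>\<close> over
  the inverse branches \<open>G\<close> of \<open>T\<close>. A branch contracts by \<open>\<alpha>\<close> and the logarithm of its weight \<open>\<bar>G'\<bar>\<close>
  has Lipschitz constant \<open>\<Delta>\<close>, so each term has the logarithmic Lipschitz constant \<open>\<alpha> * C + \<Delta>\<close>,
  and so has the sum. For \<open>C = \<Delta> / (1 - \<alpha>)\<close> the resulting cone of functions is invariant under \<open>L\<close>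
  (\<open>log_lipschitz_transfer_op\<close>). It contains the constants and is convex, hence it contains all
  averages \<open>g\<^sub>n\<close> (\<open>log_lipschitz_cesaro\<close>).

  A bound on the norms in \<open>W\<^sup>1\<^sup>,\<^sup>1\<close> alone would give only a limit of bounded variation. The cone,
  however, is defined by pointwise inequalities and is closed under limits almost everywhere, up
  to the choice of a representative (\<open>cesaro_limit_representative\<close>). So \<open>h\<close> has a
  representative \<open>u\<close> in the cone. Since \<open>u\<close> is then Lipschitz, it lies in \<open>W\<^sup>1\<^sup>,\<^sup>1\<close>. Once \<open>\<bar>u'\<bar> \<le> C * u\<close>
  is known, integration yields the norm bound \<open>1 + C\<close>, and this is at most
  \<open>(\<Delta> + 1) / (1 - \<alpha>)\<close>.

  The inequality for \<open>u'\<close> needs \<open>u'\<close> to exist. Instead of appealing to differentiability almost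
  everywhere of Lipschitz functions, the proof uses the invariance of \<open>u\<close> to show that \<open>u\<close>
  is differentiable everywhere (\<open>invariant_differentiable\<close>). By continuity \<open>L u = u\<close> holds at every
  point (\<open>representative_invariant\<close>). If \<open>u\<close> is differentiable at every \<open>x\<close> up to an error of
  \<open>M * u x\<close> in the slope, then the branches transform this error in \<open>L u\<close> into \<open>\<alpha> * M * u x\<close>. As \<open>L u = u\<close>, the
  step can be iterated, and the error is zero.
\<close>

section \<open>Lifting to the real line\<close>

lemma to_circle_add_int [simp]: "to_circle (t + of_int k) = to_circle t"
  by (simp add: to_circle_eq_iff)

lemma to_circle_add_1 [simp]: "to_circle (t + 1) = to_circle t"
  by (simp add: to_circle_eq_iff)

lemma to_circle_frac [simp]: "to_circle (frac t) = to_circle t"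
  by (simp add: to_circle_eq_iff frac_def)

lemma ex_shift_of_to_circle_eq:
  assumes "to_circle s = to_circle t"
  obtains k :: int where "s = t + of_int k"
proof -
  have "s - t \<in> \<int>"
    using assms by (simp add: to_circle_eq_iff)
  then obtain k :: int where "s - t = of_int k"
    by (auto elim: Ints_cases)
  then show thesis
    using that[of k] by simp
qed

text \<open>
  Realizes the circle as the unit circle of the complex plane, so that equality of points
  becomes equality of values of a differentiable function.
\<close>

lemma cis_eq_iff_to_circle_eq:
  "cis (2 * pi * s) = cis (2 * pi * t) \<longleftrightarrow> to_circle s = to_circle t"
proof
  assume "cis (2 * pi * s) = cis (2 * pi * t)"
  then have "exp (\<i> * complex_of_real (2 * pi * s)) = exp (\<i> * complex_of_real (2 * pi * t))"
    by (simp add: cis_conv_exp)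
  then obtain k :: int where
    "\<i> * complex_of_real (2 * pi * s) = \<i> * complex_of_real (2 * pi * t) + of_int (2 * k) * pi * \<i>"
    unfolding exp_eq by blast
  then have "2 * pi * s = 2 * pi * (t + of_int k)"
    by (simp add: complex_eq_iff algebra_simps)
  then have "s = t + of_int k"
    by simp
  then show "to_circle s = to_circle t"
    by simp
next
  assume "to_circle s = to_circle t"
  then obtain k :: int where "s = t + of_int k"
    by (rule ex_shift_of_to_circle_eq)
  then have "cis (2 * pi * s) = cis (2 * pi * t) * cis (2 * pi * of_int k)"
    by (simp add: algebra_simps cis_mult)
  then show "cis (2 * pi * s) = cis (2 * pi * t)"
    by simp
qed

lemma has_circle_deriv_imp_local_lift:
  assumes "has_circle_deriv T D (to_circle t)"
  obtains F where "\<forall>\<^sub>F s in nhds t. T (to_circle s) = to_circle (F s)"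
    "(F has_real_derivative D) (at t)"
proof -
  obtain u F where u: "to_circle u = to_circle t"
    and F: "\<forall>\<^sub>F s in nhds u. T (to_circle s) = to_circle (F s)" "(F has_real_derivative D) (at u)"
    using assms unfolding has_circle_deriv_def by blast
  obtain k :: int where k: "u = t + of_int k"
    using u by (rule ex_shift_of_to_circle_eq)
  have "((\<lambda>s. F (s + of_int k)) has_real_derivative D) (at t)"
    using F(2) k DERIV_shift[of F D t "of_int k"] by simp
  moreover have "filterlim (\<lambda>s. s + of_int k) (nhds u) (nhds t)"
    unfolding k by (auto intro!: tendsto_eq_intros filterlim_ident)
  then have "\<forall>\<^sub>F s in nhds t. T (to_circle (s + of_int k)) = to_circle (F (s + of_int k))"
    using F(1) by (rule eventually_compose_filterlim[rotated])
  ultimately show thesis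
    using that by simp
qed

lemma has_fun_deriv_to_circle_iff:
  "has_fun_deriv f D (to_circle t) \<longleftrightarrow>
     ((\<lambda>s. f (to_circle s)) has_real_derivative D) (at t)"
proof
  assume "has_fun_deriv f D (to_circle t)"
  then obtain u where u: "to_circle u = to_circle t"
    and D: "((\<lambda>s. f (to_circle s)) has_real_derivative D) (at u)"
    unfolding has_fun_deriv_def by blast
  obtain k :: int where k: "u = t + of_int k"
    using u by (rule ex_shift_of_to_circle_eq)
  show "((\<lambda>s. f (to_circle s)) has_real_derivative D) (at t)"
    using D k DERIV_shift[of "\<lambda>s. f (to_circle s)" D t "of_int k"] by simp
qed (auto simp: has_fun_deriv_def)

lemma fun_deriv_to_circle_eq:
  assumes "((\<lambda>s. f (to_circle s)) has_real_derivative D) (at t)"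
  shows "fun_deriv f (to_circle t) = D"
  using assms unfolding fun_deriv_def
  by (intro the_equality) (auto simp: has_fun_deriv_to_circle_iff intro: DERIV_unique)

lemma has_circle_deriv_circle_deriv:
  assumes "C2_circle_map T"
  shows "has_circle_deriv T (circle_deriv T x) x"
proof -
  obtain D where D: "has_circle_deriv T D x"
    using assms unfolding C2_circle_map_def by blast
  then have "circle_deriv T x = D"
    unfolding circle_deriv_def by (intro the_equality) (auto intro: has_circle_deriv_unique)
  with D show ?thesis by simp
qed

lemma circle_deriv_has_real_derivative:
  assumes "C2_circle_map T"
  shows "((\<lambda>s. circle_deriv T (to_circle s)) has_real_derivative
           fun_deriv (circle_deriv T) (to_circle t)) (at t)"
proof -
  obtain D where "has_fun_deriv (circle_deriv T) D (to_circle t)"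
    using assms unfolding C2_circle_map_def by blast
  then show ?thesis
    by (simp add: has_fun_deriv_to_circle_iff fun_deriv_to_circle_eq)
qed

text \<open>
  A lift has to be an antiderivative \<open>F\<close> of \<open>T'\<close>, normalized at \<open>0\<close>. It is one because the quotient
  \<open>E\<close> of \<open>T\<close> and \<open>F\<close> on the unit circle is locally \<open>cis (2 * pi * (H - F))\<close> with a local lift \<open>H\<close> of
  \<open>T\<close>. Its derivative is therefore zero, and no gluing of the local lifts is required.
\<close>

lemma ex_lift:
  assumes T: "C2_circle_map T"
  obtains F where "\<And>t. T (to_circle t) = to_circle (F t)"
    "\<And>t. (F has_real_derivative circle_deriv T (to_circle t)) (at t)"
proof -
  define D where "D t = circle_deriv T (to_circle t)" for t
  have "isCont D t" for t
    using circle_deriv_has_real_derivative[OF T, of t] unfolding D_def by (rule DERIV_isCont)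
  then obtain F0 where F0: "(F0 has_vector_derivative D t) (at t)" for t :: real
    using einterval_antiderivative[of "-\<infinity>" \<infinity> D] by auto
  obtain c where c: "to_circle c = T (to_circle 0)"
    using surj_to_circle by blast
  define F where "F t = F0 t + (c - F0 0)" for t
  have F: "(F has_real_derivative D t) (at t)" for t
    using F0[of t] unfolding F_def has_real_derivative_iff_has_vector_derivative
    by (auto intro!: derivative_eq_intros)
  define R where "R x = (SOME r. to_circle r = x)" for x
  have R: "to_circle (R x) = x" for x
    unfolding R_def by (rule someI_ex) (rule surj_to_circle)
  \<comment> \<open>the point of the unit circle that measures by how much \<open>F\<close> fails to lift \<open>T\<close>; it is
    locally given by differentiable lifts, which \<open>R\<close> itself need not be\<close>
  define E where "E t = cis (2 * pi * (R (T (to_circle t)) - F t))" for t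
  have dE: "(E has_vector_derivative 0) (at t)" for t
  proof -
    obtain H where H: "\<forall>\<^sub>F s in nhds t. T (to_circle s) = to_circle (H s)"
      "(H has_real_derivative D t) (at t)"
      using has_circle_deriv_imp_local_lift[OF has_circle_deriv_circle_deriv[OF T, of "to_circle t"]]
      unfolding D_def by blast
    have "((\<lambda>s. cis (2 * pi * (H s - F s))) has_vector_derivative 0) (at t)"
    proof -
      have *: "((\<lambda>s. 2 * pi * (H s - F s)) has_real_derivative 0) (at t)"
        using H(2) F[of t] by (auto intro!: derivative_eq_intros)
      show ?thesis
        using has_derivative_cis[OF *[unfolded has_field_derivative_def]]
        by (simp add: has_vector_derivative_def)
    qed
    moreover have "\<forall>\<^sub>F s in nhds t. E s = cis (2 * pi * (H s - F s))"
      using H(1)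
    proof eventually_elim
      case (elim s)
      then have "cis (2 * pi * R (T (to_circle s))) = cis (2 * pi * H s)"
        by (simp add: cis_eq_iff_to_circle_eq R)
      then show ?case
        by (simp add: E_def right_diff_distrib flip: cis_divide)
    qed
    moreover from this have "E t = cis (2 * pi * (H t - F t))"
      by (rule eventually_nhds_x_imp_x)
    ultimately show ?thesis
      using has_vector_derivative_cong_ev[of UNIV E "\<lambda>s. cis (2 * pi * (H s - F s))" t] by simp
  qed
  have "E t = E 0" for t
    using has_vector_derivative_zero_constant[of UNIV E] dE 
    by (metis UNIV_I convex_UNIV)
  moreover have "E 0 = 1"
  proof -
    have "cis (2 * pi * R (T (to_circle 0))) = cis (2 * pi * F 0)"
      by (simp add: cis_eq_iff_to_circle_eq R F_def c)
    then show ?thesis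
      by (simp add: E_def right_diff_distrib flip: cis_divide)
  qed
  ultimately have "cis (2 * pi * R (T (to_circle t))) = cis (2 * pi * F t)" for t
    by (simp add: E_def right_diff_distrib flip: cis_divide)
  then have "T (to_circle t) = to_circle (F t)" for t
    by (simp add: cis_eq_iff_to_circle_eq R)
  with F show thesis
    using that unfolding D_def by blast
qed

section \<open>Inverse branches of an expanding map\<close>

text \<open>
  The inverse branches of \<open>T\<close>, read in the charts: on the line \<open>T\<close> becomes a bijection with
  inverse \<open>G\<^sub>0\<close>, and its translates \<open>G k x = G\<^sub>0 (x + k)\<close> enumerate the preimages of the point
  below \<open>x\<close> while \<open>k\<close> runs through the residues modulo the degree. The constant \<open>\<Delta>\<close> bounds the
  distortion, that is, the logarithmic derivative of the weights \<open>\<bar>G' k x\<bar>\<close>.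
\<close>

locale inverse_branches =
  fixes T :: "circle \<Rightarrow> circle" and J :: "int set"
    and G G' W :: "int \<Rightarrow> real \<Rightarrow> real" and \<alpha> \<Delta> :: real
  assumes finite_J: "finite J"
    and transfer_op_to_circle:
      "transfer_op T f (to_circle x) = (\<Sum>k\<in>J. f (to_circle (G k x)) * \<bar>G' k x\<bar>)"
    and DERIV_G: "(G k has_real_derivative G' k x) (at x)"
    and G'_nonzero: "G' k x \<noteq> 0"
    and G'_le: "\<bar>G' k x\<bar> \<le> \<alpha>"
    and DERIV_weight: "((\<lambda>x. \<bar>G' k x\<bar>) has_real_derivative W k x) (at x)"
    and distortion: "\<bar>W k x\<bar> \<le> \<Delta> * \<bar>G' k x\<bar>"
    and \<alpha>_less_1: "\<alpha> < 1"

lemma DERIV_abs_of_nonzero: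
  assumes f: "(f has_real_derivative D) (at t)" and "f t \<noteq> 0"
  shows "((\<lambda>s. \<bar>f s\<bar>) has_real_derivative sgn (f t) * D) (at t)"
proof -
  have lim: "(f \<longlongrightarrow> f t) (nhds t)"
    using DERIV_isCont[OF f] by (simp only: isCont_def tendsto_at_iff_tendsto_nhds)
  have "\<forall>\<^sub>F s in nhds t. \<bar>f s\<bar> = sgn (f t) * f s"
  proof (cases "f t > 0")
    case True
    show ?thesis
      using order_tendstoD(1)[OF lim True] by eventually_elim (use True in simp)
  next
    case False
    with assms(2) have "f t < 0" by simp
    show ?thesis
      using order_tendstoD(2)[OF lim \<open>f t < 0\<close>] by eventually_elim (use \<open>f t < 0\<close> in simp)
  qed
  then have "((\<lambda>s. \<bar>f s\<bar>) has_real_derivative sgn (f t) * D) (at t) \<longleftrightarrow>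
      ((\<lambda>s. sgn (f t) * f s) has_real_derivative sgn (f t) * D) (at t)"
    by (intro DERIV_cong_ev) auto
  then show ?thesis
    using DERIV_cmult[OF f, of "sgn (f t)"] by simp
qed

text \<open>
  The supremum is attained on the compact fundamental domain \<open>[0,1]\<close>. This turns the pointwise
  bound \<open>\<bar>T'\<bar> > 1\<close> into \<open>\<alpha> < 1\<close> and makes the suprema in \<open>\<alpha>\<close> and in the distortion constant bounds.
\<close>

lemma circle_attains_sup:
  fixes f :: "circle \<Rightarrow> real"
  assumes "continuous_on UNIV (\<lambda>t. f (to_circle t))"
  obtains z where "\<And>x. f x \<le> f z"
proof -
  have "continuous_on {0..1} (\<lambda>t. f (to_circle t))"
    using assms continuous_on_subset by blast
  then obtain t where t: "\<forall>s\<in>{0..1}. f (to_circle s) \<le> f (to_circle t)"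
    using continuous_attains_sup[of "{0..1::real}" "\<lambda>t. f (to_circle t)"] by force
  have "f x \<le> f (to_circle t)" for x
  proof -
    obtain s where "to_circle s = x" using surj_to_circle by blast
    then show ?thesis
      using bspec[OF t, of "frac s"] frac_lt_1[of s] by simp
  qed
  then show thesis by (rule that)
qed

lemma circle_deriv_gt_1:
  assumes "expanding_map T"
  shows "1 < \<bar>circle_deriv T x\<bar>"
  using assms by (simp add: expanding_map_def)

lemma circle_deriv_nonzero:
  assumes "expanding_map T"
  shows "circle_deriv T x \<noteq> 0"
  using circle_deriv_gt_1[OF assms, of x] by auto

context
  fixes T :: "circle \<Rightarrow> circle" and F :: "real \<Rightarrow> real"
  assumes expanding: "expanding_map T"
    and lift: "T (to_circle t) = to_circle (F t)"
    and DERIV_lift: "(F has_real_derivative circle_deriv T (to_circle t)) (at t)"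
begin

lemma lift_expands: "\<bar>s - t\<bar> \<le> \<bar>F s - F t\<bar>"
proof -
  have *: "t - s \<le> \<bar>F t - F s\<bar>" if st: "s < t" for s t
  proof -
    obtain z where "F t - F s = (t - s) * circle_deriv T (to_circle z)"
      using MVT2[OF st, of F "\<lambda>z. circle_deriv T (to_circle z)"] DERIV_lift by auto
    then show ?thesis
      using st circle_deriv_gt_1[OF expanding, of "to_circle z"] by (simp add: abs_mult)
  qed
  show ?thesis
    using *[of s t] *[of t s] by (cases s t rule: linorder_cases) auto
qed

lemma inj_lift: "inj F"
  using lift_expands by (intro injI) (metis abs_le_zero_iff diff_self right_minus_eq abs_zero)

text \<open>
  The function \<open>t \<mapsto> F (t + 1) - F t\<close> has derivative zero and integer values; its value \<open>d\<close> is
  the degree of \<open>T\<close>, and it is nonzero since \<open>F\<close> is injective.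
\<close>

lemma lift_degree:
  obtains d :: int where "d \<noteq> 0" "\<And>t m. F (t + of_int m) = F t + of_int (m * d)"
proof -
  have "((\<lambda>t. F (t + 1) - F t) has_real_derivative 0) (at t)" for t
    using DERIV_diff[OF DERIV_lift[of "t + 1", unfolded DERIV_shift] DERIV_lift[of t]] by simp
  then have const: "F (t + 1) - F t = F (0 + 1) - F 0" for t
    using DERIV_isconst_all[of "\<lambda>t. F (t + 1) - F t"] by blast
  have "to_circle (F (0 + 1)) = to_circle (F 0)"
    by (simp only: lift[symmetric] to_circle_add_1)
  then obtain d :: int where d: "F (0 + 1) = F 0 + of_int d"
    by (rule ex_shift_of_to_circle_eq)
  have step: "F (t + 1) = F t + of_int d" for t
    using const[of t] d by simp
  have "F (t + of_int m) = F t + of_int (m * d)" for t m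
  proof (induction m rule: int_induct[of _ 0])
    case (step1 i)
    then show ?case
      using step[of "t + of_int i"] by (simp add: algebra_simps)
  next
    case (step2 i)
    then show ?case
      using step[of "t + of_int (i - 1)"] by (simp add: algebra_simps)
  qed simp
  moreover have "d \<noteq> 0"
    using step[of 0] inj_lift[THEN injD, of 1 0] by auto
  ultimately show thesis
    using that by blast
qed

lemma surj_lift: "surj F"
proof -
  obtain d :: int where d: "d \<noteq> 0" "\<And>t m. F (t + of_int m) = F t + of_int (m * d)"
    using lift_degree by blast
  have conn: "connected (range F)"
    using DERIV_lift
    by (intro connected_continuous_image connected_UNIV continuous_at_imp_continuous_on)
       (auto intro: DERIV_isCont)
  have "y \<in> range F" for y
  proof -
    define n where "n = \<lceil>\<bar>y - F 0\<bar>\<rceil>"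
    have "\<bar>of_int n\<bar> \<le> \<bar>of_int (n * d) :: real\<bar>"
    proof -
      have "1 \<le> \<bar>d\<bar>" using d(1) by simp
      then have "\<bar>n\<bar> * 1 \<le> \<bar>n\<bar> * \<bar>d\<bar>"
        by (intro mult_left_mono) auto
      then have "\<bar>n\<bar> \<le> \<bar>n * d\<bar>"
        by (simp add: abs_mult)
      then show ?thesis
        by (simp only: of_int_abs[symmetric] of_int_le_iff)
    qed
    then have "\<bar>y - F 0\<bar> \<le> \<bar>of_int (n * d)\<bar>"
      unfolding n_def by linarith
    moreover have "F (of_int n) = F 0 + of_int (n * d)" "F (of_int (- n)) = F 0 - of_int (n * d)"
      using d(2)[of 0 n] d(2)[of 0 "- n"] by simp_all
    ultimately have "F (of_int n) \<le> y \<and> y \<le> F (of_int (- n)) \<or> F (of_int (- n)) \<le> y \<and> y \<le> F (of_int n)"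
      by linarith
    then show ?thesis
      using connectedD_interval[OF conn] by blast
  qed
  then show ?thesis by blast
qed

abbreviation G\<^sub>0 :: "real \<Rightarrow> real" where "G\<^sub>0 \<equiv> inv F"

lemma lift_inv [simp]: "F (G\<^sub>0 x) = x"
  by (rule surj_f_inv_f[OF surj_lift])

lemma inv_lift [simp]: "G\<^sub>0 (F t) = t"
  by (rule inv_f_f[OF inj_lift])

lemma DERIV_inv_lift: "(G\<^sub>0 has_real_derivative inverse (circle_deriv T (to_circle (G\<^sub>0 x)))) (at x)"
proof -
  have "\<bar>G\<^sub>0 x - G\<^sub>0 y\<bar> \<le> \<bar>x - y\<bar>" for x y
    using lift_expands[of "G\<^sub>0 x" "G\<^sub>0 y"] by simp
  then have "continuous_on UNIV G\<^sub>0"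
    unfolding continuous_on_iff dist_real_def by (metis UNIV_I order_le_less_trans)
  then have "isCont G\<^sub>0 x"
    by (simp add: continuous_on_eq_continuous_at)
  then show ?thesis
    by (intro DERIV_inverse_function[OF DERIV_lift circle_deriv_nonzero[OF expanding], of "x - 1" x "x + 1"]) auto
qed

text \<open>
  A point below \<open>s\<close> is a preimage iff \<open>F s = x + k\<close> for an integer \<open>k\<close>. Translating \<open>s\<close> by an
  integer \<open>m\<close> changes \<open>k\<close> by \<open>m * d\<close>, so preimages correspond to residues of \<open>k\<close> modulo \<open>\<bar>d\<bar>\<close>; the
  absolute value covers maps that reverse the orientation.
\<close>

lemma bij_betw_preimages:
  assumes d: "d \<noteq> 0" "\<And>t m. F (t + of_int m) = F t + of_int (m * d)"
  shows "bij_betw (\<lambda>k. to_circle (G\<^sub>0 (x + of_int k))) {0..<\<bar>d\<bar>} (T -` {to_circle x})"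
proof (rule bij_betwI')
  fix j k assume jk: "j \<in> {0..<\<bar>d\<bar>}" "k \<in> {0..<\<bar>d\<bar>}"
  show "to_circle (G\<^sub>0 (x + of_int j)) = to_circle (G\<^sub>0 (x + of_int k)) \<longleftrightarrow> j = k"
  proof
    assume "to_circle (G\<^sub>0 (x + of_int j)) = to_circle (G\<^sub>0 (x + of_int k))"
    then obtain m :: int where "G\<^sub>0 (x + of_int j) = G\<^sub>0 (x + of_int k) + of_int m"
      by (rule ex_shift_of_to_circle_eq)
    then have "F (G\<^sub>0 (x + of_int j)) = F (G\<^sub>0 (x + of_int k)) + of_int (m * d)"
      by (simp only: d(2))
    then have "real_of_int j = of_int (k + m * d)"
      by simp
    then have "j = k + m * d"
      by (simp only: of_int_eq_iff)
    then have "j mod \<bar>d\<bar> = k mod \<bar>d\<bar>"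
      by (simp add: mod_eq_dvd_iff)
    with jk show "j = k" by simp
  qed simp
next
  fix k show "to_circle (G\<^sub>0 (x + of_int k)) \<in> T -` {to_circle x}"
    by (simp add: lift)
next
  fix y assume y: "y \<in> T -` {to_circle x}"
  obtain s where s: "to_circle s = y"
    using surj_to_circle by blast
  with y have "to_circle (F s) = to_circle x"
    by (simp flip: lift)
  then obtain k :: int where k: "F s = x + of_int k"
    by (rule ex_shift_of_to_circle_eq)
  define j where "j = k mod \<bar>d\<bar>"
  have "d dvd j - k"
    unfolding j_def by (metis abs_dvd_iff dvd_minus_mod dvd_diff_commute)
  then obtain m where "j = k + m * d"
    by (metis add_diff_cancel_left' diff_add_cancel dvd_def mult.commute add.commute)
  then have "F (s + of_int m) = x + of_int j"
    using d(2)[of s m] k by simp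
  then have "s + of_int m = G\<^sub>0 (x + of_int j)"
    by (metis inv_lift)
  then have "y = to_circle (G\<^sub>0 (x + of_int j))"
    using s by (metis to_circle_add_int)
  moreover have "j \<in> {0..<\<bar>d\<bar>}"
    using d(1) by (simp add: j_def)
  ultimately show "\<exists>k\<in>{0..<\<bar>d\<bar>}. y = to_circle (G\<^sub>0 (x + of_int k))"
    by blast
qed

end

text \<open>
  By the inverse function rule \<open>G' = 1 / T'(G)\<close>, hence \<open>(log \<bar>G'\<bar>)' = - T''(G) * G' / T'(G)\<close>, which is
  \<open>- T'' / (T')\<^sup>2\<close> at \<open>G\<close>. This is why the distortion is controlled by the norm in the theorem.
\<close>

lemma expanding_map_inverse_branches:
  assumes T: "expanding_map T"
  obtains J G G' W where
    "inverse_branches T J G G' W (SUP x. 1 / \<bar>circle_deriv T x\<bar>)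
       (sup_norm (\<lambda>x. fun_deriv (circle_deriv T) x / (circle_deriv T x)\<^sup>2))"
proof -
  have C2: "C2_circle_map T"
    using T by (simp add: expanding_map_def)
  obtain F where F: "\<And>t. T (to_circle t) = to_circle (F t)"
    "\<And>t. (F has_real_derivative circle_deriv T (to_circle t)) (at t)"
    using ex_lift[OF C2] by blast
  obtain d :: int where d: "d \<noteq> 0" "\<And>t m. F (t + of_int m) = F t + of_int (m * d)"
    using lift_degree[OF T F] by blast
  define D where "D t = circle_deriv T (to_circle t)" for t
  define E where "E t = fun_deriv (circle_deriv T) (to_circle t)" for t
  have DE: "(D has_real_derivative E t) (at t)" for t
    unfolding D_def E_def by (rule circle_deriv_has_real_derivative[OF C2])
  have D: "1 < \<bar>D t\<bar>" "D t \<noteq> 0" for t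
    unfolding D_def by (rule circle_deriv_gt_1[OF T]) (rule circle_deriv_nonzero[OF T])
  have cont_D: "continuous_on UNIV D"
    using DE by (intro continuous_at_imp_continuous_on) (auto intro: DERIV_isCont)
  have cont_E: "continuous_on UNIV E"
    using C2 continuous_on_compose2[OF _ continuous_to_circle, of UNIV "fun_deriv (circle_deriv T)"]
    unfolding C2_circle_map_def E_def by simp

  have "continuous_on UNIV (\<lambda>t. 1 / \<bar>D t\<bar>)"
    using D(2) by (intro continuous_intros cont_D) auto
  then obtain z where z: "\<And>x. 1 / \<bar>circle_deriv T x\<bar> \<le> 1 / \<bar>circle_deriv T z\<bar>"
    unfolding D_def using circle_attains_sup[of "\<lambda>x. 1 / \<bar>circle_deriv T x\<bar>"] by blast
  define \<alpha> where "\<alpha> = (SUP x. 1 / \<bar>circle_deriv T x\<bar>)"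
  have "\<alpha> \<le> 1 / \<bar>circle_deriv T z\<bar>"
    unfolding \<alpha>_def using z by (intro cSUP_least) auto
  also have "\<dots> < 1"
    using circle_deriv_gt_1[OF T, of z] by simp
  finally have \<alpha>: "\<alpha> < 1" .
  have \<alpha>_upper: "inverse \<bar>D t\<bar> \<le> \<alpha>" for t
    unfolding \<alpha>_def D_def inverse_eq_divide using z
    by (intro cSUP_upper2[where x = "to_circle t"] bdd_aboveI2) auto

  define \<Delta> where "\<Delta> = sup_norm (\<lambda>x. fun_deriv (circle_deriv T) x / (circle_deriv T x)\<^sup>2)"
  have "continuous_on UNIV (\<lambda>t. \<bar>E t / (D t)\<^sup>2\<bar>)"
    using D(2) by (intro continuous_intros cont_D cont_E) auto
  then obtain z' where z': "\<And>x. \<bar>fun_deriv (circle_deriv T) x / (circle_deriv T x)\<^sup>2\<bar> \<le>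
      \<bar>fun_deriv (circle_deriv T) z' / (circle_deriv T z')\<^sup>2\<bar>"
    unfolding D_def E_def 
    using circle_attains_sup[of "\<lambda>x. \<bar>fun_deriv (circle_deriv T) x / (circle_deriv T x)\<^sup>2\<bar>"] by blast
  have \<Delta>_upper: "\<bar>E t / (D t)\<^sup>2\<bar> \<le> \<Delta>" for t
    unfolding \<Delta>_def D_def E_def sup_norm_def using z'
    by (intro cSUP_upper2[where x = "to_circle t"] bdd_aboveI2) auto

  define G where "G k x = inv F (x + of_int k)" for k :: int and x
  define G' where "G' k x = inverse (D (G k x))" for k x
  define W where "W k x = - (sgn (D (G k x)) * E (G k x) * G' k x) * (inverse (D (G k x)))\<^sup>2" for k x
  have DERIV_G: "(G k has_real_derivative G' k x) (at x)" for k x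
    using DERIV_inv_lift[OF T F, of "x + of_int k"]
    unfolding G_def G'_def D_def DERIV_shift .
  have "inverse_branches T {0..<\<bar>d\<bar>} G G' W \<alpha> \<Delta>"
  proof
    show "transfer_op T f (to_circle x) = (\<Sum>k\<in>{0..<\<bar>d\<bar>}. f (to_circle (G k x)) * \<bar>G' k x\<bar>)" for f x
      unfolding transfer_op_def
        sum.reindex_bij_betw[OF bij_betw_preimages[OF T F d, of x], symmetric]
      by (simp add: G_def G'_def D_def divide_inverse abs_inverse)
    show "\<bar>G' k x\<bar> \<le> \<alpha>" for k x
      using \<alpha>_upper by (simp add: G'_def abs_inverse)
    show "((\<lambda>x. \<bar>G' k x\<bar>) has_real_derivative W k x) (at x)" for k x
    proof -
      have "((\<lambda>x. D (G k x)) has_real_derivative E (G k x) * G' k x) (at x)"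
        using DERIV_chain2[OF DE DERIV_G] .
      from DERIV_inverse'[OF DERIV_abs_of_nonzero[OF this D(2)]] D(2)
      show ?thesis
        by (simp add: W_def G'_def abs_inverse power2_eq_square mult_ac)
           (simp add: inverse_eq_divide field_simps)
    qed
    show "\<bar>W k x\<bar> \<le> \<Delta> * \<bar>G' k x\<bar>" for k x
    proof -
      have "\<bar>W k x\<bar> = \<bar>E (G k x) / (D (G k x))\<^sup>2\<bar> * \<bar>G' k x\<bar>"
        using D(2)[of "G k x"]
        by (simp add: W_def abs_mult abs_divide abs_inverse sgn_if divide_simps power2_eq_square)
      then show ?thesis
        using mult_right_mono[OF \<Delta>_upper[of "G k x"], of "\<bar>G' k x\<bar>"] by simp
    qed
    show "G' k x \<noteq> 0" for k x
      using D(2) by (simp add: G'_def)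
  qed (use DERIV_G \<alpha> in simp_all)
  then show thesis
    using that unfolding \<alpha>_def \<Delta>_def by blast
qed

section \<open>Logarithmically Lipschitz functions\<close>

text \<open>
  For positive \<open>f\<close> this says that \<open>log f\<close> is Lipschitz with constant \<open>C\<close>; for differentiable ones
  it says \<open>\<bar>f'\<bar> \<le> C * f\<close>. Written without logarithm or derivative, the condition defines a convex
  cone that is closed under pointwise limits.
\<close>

definition log_lipschitz :: "real \<Rightarrow> (real \<Rightarrow> real) \<Rightarrow> bool" where
  "log_lipschitz C f \<longleftrightarrow> (\<forall>t. 0 \<le> f t) \<and> (\<forall>s t. f s \<le> exp (C * \<bar>s - t\<bar>) * f t)"

lemma log_lipschitz_nonneg: "log_lipschitz C f \<Longrightarrow> 0 \<le> f t"
  by (simp add: log_lipschitz_def)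

lemma log_lipschitz_le: "log_lipschitz C f \<Longrightarrow> f s \<le> exp (C * \<bar>s - t\<bar>) * f t"
  by (simp add: log_lipschitz_def)

lemma log_lipschitz_of_deriv:
  assumes deriv: "\<And>t. (f has_real_derivative f' t) (at t)"
    and pos: "\<And>t. 0 < f t" and bound: "\<And>t. \<bar>f' t\<bar> \<le> C * f t"
  shows "log_lipschitz C f"
  unfolding log_lipschitz_def
proof (intro conjI allI)
  fix s t
  have ln: "((\<lambda>t. ln (f t)) has_real_derivative f' x / f x) (at x)" for x
    using DERIV_ln_divide[OF pos] deriv by (auto intro!: derivative_eq_intros simp: pos)
  have q: "\<bar>f' x / f x\<bar> \<le> C" for x
    using bound[of x] pos[of x] by (simp add: abs_divide divide_le_eq)
  have "norm (ln (f s) - ln (f t)) \<le> C * norm (s - t)"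
    by (rule field_differentiable_bound[of UNIV "\<lambda>t. ln (f t)" "\<lambda>x. f' x / f x"])
       (use ln q in auto)
  then have "ln (f s) \<le> C * \<bar>s - t\<bar> + ln (f t)"
    by auto
  then have "exp (ln (f s)) \<le> exp (C * \<bar>s - t\<bar> + ln (f t))"
    by simp
  then show "f s \<le> exp (C * \<bar>s - t\<bar>) * f t"
    using pos by (simp add: exp_add)
qed (use pos in \<open>simp add: less_imp_le\<close>)

lemma log_lipschitz_mult:
  assumes f: "log_lipschitz A f" and g: "log_lipschitz B g"
  shows "log_lipschitz (A + B) (\<lambda>t. f t * g t)"
  unfolding log_lipschitz_def
proof (intro conjI allI)
  fix s t
  have "f s * g s \<le> (exp (A * \<bar>s - t\<bar>) * f t) * (exp (B * \<bar>s - t\<bar>) * g t)"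
    by (intro mult_mono log_lipschitz_le[OF f] log_lipschitz_le[OF g])
       (simp_all add: log_lipschitz_nonneg[OF f] log_lipschitz_nonneg[OF g])
  also have "\<dots> = exp ((A + B) * \<bar>s - t\<bar>) * (f t * g t)"
    by (simp add: distrib_right exp_add)
  finally show "f s * g s \<le> exp ((A + B) * \<bar>s - t\<bar>) * (f t * g t)" .
qed (simp add: log_lipschitz_nonneg[OF f] log_lipschitz_nonneg[OF g])

lemma log_lipschitz_compose:
  assumes f: "log_lipschitz C f" and "0 \<le> C" and g: "\<And>s t. \<bar>g s - g t\<bar> \<le> a * \<bar>s - t\<bar>"
  shows "log_lipschitz (C * a) (\<lambda>t. f (g t))"
  unfolding log_lipschitz_def
proof (intro conjI allI)
  fix s t
  have "C * \<bar>g s - g t\<bar> \<le> C * a * \<bar>s - t\<bar>"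
    using mult_left_mono[OF g \<open>0 \<le> C\<close>, of s t] by (simp add: mult.assoc)
  then have "exp (C * \<bar>g s - g t\<bar>) * f (g t) \<le> exp (C * a * \<bar>s - t\<bar>) * f (g t)"
    by (intro mult_right_mono log_lipschitz_nonneg[OF f]) simp
  then show "f (g s) \<le> exp (C * a * \<bar>s - t\<bar>) * f (g t)"
    using log_lipschitz_le[OF f, of "g s" "g t"] by simp
qed (rule log_lipschitz_nonneg[OF f])

lemma log_lipschitz_sum:
  assumes "\<And>i. i \<in> I \<Longrightarrow> log_lipschitz C (f i)"
  shows "log_lipschitz C (\<lambda>t. \<Sum>i\<in>I. f i t)"
  using assms unfolding log_lipschitz_def
  by (auto simp: sum_distrib_left intro!: sum_nonneg sum_mono)

lemma log_lipschitz_divide: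
  assumes "log_lipschitz C f" "0 \<le> c"
  shows "log_lipschitz C (\<lambda>t. f t / c)"
  using assms unfolding log_lipschitz_def
  by (auto intro: divide_right_mono)

lemma log_lipschitz_const: "0 \<le> C \<Longrightarrow> 0 \<le> c \<Longrightarrow> log_lipschitz C (\<lambda>_. c)"
  by (auto simp: log_lipschitz_def mult_le_cancel_right1)

text \<open>
  An estimate of the increment that is first order in \<open>\<bar>s - t\<bar>\<close> with coefficient \<open>C * f t\<close>; it
  gives both continuity and the bound on the derivative.
\<close>

lemma log_lipschitz_diff_le:
  assumes f: "log_lipschitz C f" and "0 \<le> C"
  shows "\<bar>f s - f t\<bar> \<le> exp (C * \<bar>s - t\<bar>) * f t - f t"
proof -
  define e where "e = exp (C * \<bar>s - t\<bar>)"
  have e: "1 \<le> e"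
    using \<open>0 \<le> C\<close> by (simp add: e_def)
  have 1: "f s \<le> e * f t" "f t \<le> e * f s"
    using log_lipschitz_le[OF f, of s t] log_lipschitz_le[OF f, of t s]
    by (simp_all add: e_def abs_minus_commute)
  have "e * (2 * f t) \<le> (e * e + 1) * f t"
    using mult_right_mono[OF zero_le_power2[of "e - 1"] log_lipschitz_nonneg[OF f, of t]]
    by (simp add: power2_eq_square algebra_simps)
  with 1(2) have "e * (2 * f t) \<le> e * (e * f t + f s)"
    by (simp add: algebra_simps)
  then have "2 * f t \<le> e * f t + f s"
    using e by simp
  with 1(1) show ?thesis
    unfolding e_def by simp
qed

lemma log_lipschitz_continuous:
  assumes f: "log_lipschitz C f" and "0 \<le> C"
  shows "continuous_on UNIV f"
proof (intro continuous_at_imp_continuous_on ballI)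
  fix t
  have "((\<lambda>s. exp (C * \<bar>s - t\<bar>) * f t - f t) \<longlongrightarrow> exp (C * \<bar>t - t\<bar>) * f t - f t) (at t)"
    by (intro tendsto_intros)
  then have "((\<lambda>s. exp (C * \<bar>s - t\<bar>) * f t - f t) \<longlongrightarrow> 0) (at t)"
    by simp
  then have "((\<lambda>s. f s - f t) \<longlongrightarrow> 0) (at t)"
    by (rule Lim_null_comparison[rotated]) (simp add: log_lipschitz_diff_le[OF assms])
  then show "isCont f t"
    by (simp add: isCont_def LIM_zero_iff)
qed

text \<open>
  On \<open>S\<close> the limit inherits the inequality defining the cone. Off \<open>S\<close>, where the functions
  may diverge, it is extended by the multiplicative form of McShane's formula,
  \<open>u x = inf (exp (C * \<bar>x - t\<bar>) * h t)\<close> over \<open>t\<close> in \<open>S\<close>.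
\<close>

lemma log_lipschitz_limit_extends:
  fixes h :: "circle \<Rightarrow> real"
  assumes g: "\<And>n. log_lipschitz C (\<lambda>t. g n (to_circle t))"
    and lim: "\<And>x. x \<in> S \<Longrightarrow> (\<lambda>n. g n x) \<longlonglongrightarrow> h x"
    and "S \<noteq> {}" "0 \<le> C"
  obtains u where "log_lipschitz C (\<lambda>t. u (to_circle t))" "\<And>x. x \<in> S \<Longrightarrow> u x = h x"
proof -
  have h_nonneg: "0 \<le> h x" if "x \<in> S" for x
  proof (rule LIMSEQ_le_const[OF lim[OF that]])
    obtain t where "to_circle t = x" using surj_to_circle by blast
    then show "\<exists>N. \<forall>n\<ge>N. 0 \<le> g n x"
      using log_lipschitz_nonneg[OF g, of _ t] by simp
  qed
  have h_le: "h (to_circle s) \<le> exp (C * \<bar>s - t\<bar>) * h (to_circle t)"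
    if "to_circle s \<in> S" "to_circle t \<in> S" for s t
    by (rule LIMSEQ_le[OF lim[OF that(1)] tendsto_mult_left[OF lim[OF that(2)]]])
       (use log_lipschitz_le[OF g] in auto)
  define P where "P x = {(s, t). to_circle s = x \<and> to_circle t \<in> S}" for x
  define b where "b = (\<lambda>(s, t). exp (C * \<bar>s - t\<bar>) * h (to_circle t))"
  \<comment> \<open>ranging over all lifts \<open>s\<close> of \<open>x\<close> makes the infimum a function on the circle\<close>
  define u where "u x = (INF p\<in>P x. b p)" for x
  have b_nonneg: "0 \<le> b p" if "p \<in> P x" for p x
    using that h_nonneg by (auto simp: P_def b_def)
  have P_nonempty: "P x \<noteq> {}" for x
  proof -
    obtain y where "y \<in> S" using \<open>S \<noteq> {}\<close> by blast
    moreover obtain s t where "to_circle s = x" "to_circle t = y"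
      using surj_to_circle by metis
    ultimately show ?thesis by (auto simp: P_def)
  qed
  have u_le: "u x \<le> b p" if "p \<in> P x" for x p
    unfolding u_def using that b_nonneg by (intro cINF_lower bdd_belowI2[where m = 0]) auto
  have "log_lipschitz C (\<lambda>t. u (to_circle t))"
    unfolding log_lipschitz_def
  proof (intro conjI allI)
    fix t show "0 \<le> u (to_circle t)"
      unfolding u_def using b_nonneg by (intro cINF_greatest P_nonempty)
  next
    fix s s'
    define e where "e = exp (C * \<bar>s - s'\<bar>)"
    have "u (to_circle s) / e \<le> b p" if p_in: "p \<in> P (to_circle s')" for p
    proof -
      obtain r t where p: "p = (r, t)" "to_circle r = to_circle s'" "to_circle t \<in> S"
        using p_in by (auto simp: P_def)
      obtain k :: int where k: "r = s' + of_int k"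
        using p(2) by (rule ex_shift_of_to_circle_eq)
      have "u (to_circle s) \<le> b (s + of_int k, t)"
        by (rule u_le) (simp add: P_def p)
      also have "\<dots> \<le> e * b p"
      proof -
        have "\<bar>s + of_int k - t\<bar> \<le> \<bar>s - s'\<bar> + \<bar>r - t\<bar>"
          unfolding k by simp
        then have "C * \<bar>s + of_int k - t\<bar> \<le> C * \<bar>s - s'\<bar> + C * \<bar>r - t\<bar>"
          using \<open>0 \<le> C\<close> by (simp add: mult_left_mono flip: distrib_left)
        then show ?thesis
          unfolding e_def b_def p using h_nonneg[OF p(3)]
          by (simp add: mult_right_mono flip: exp_add mult.assoc)
      qed
      finally show ?thesis
        by (simp add: e_def divide_le_eq mult.commute)
    qed
    then have "u (to_circle s) / e \<le> u (to_circle s')"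
      unfolding u_def[of "to_circle s'"] by (intro cINF_greatest P_nonempty)
    then show "u (to_circle s) \<le> exp (C * \<bar>s - s'\<bar>) * u (to_circle s')"
      by (simp add: e_def divide_le_eq mult.commute)
  qed
  moreover have "u x = h x" if "x \<in> S" for x
  proof (rule antisym)
    obtain t where t: "to_circle t = x" using surj_to_circle by blast
    then have "u x \<le> b (t, t)"
      using that by (intro u_le) (simp add: P_def)
    then show "u x \<le> h x"
      by (simp add: b_def t)
    show "h x \<le> u x"
      unfolding u_def using that h_le by (intro cINF_greatest P_nonempty) (auto simp: P_def b_def)
  qed
  ultimately show thesis by (rule that)
qed

context inverse_branches
begin

lemma \<alpha>_nonneg: "0 \<le> \<alpha>"
  using G'_le[of 0 0] by linarith

lemma \<Delta>_nonneg: "0 \<le> \<Delta>"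
  using distortion[of 0 0] G'_nonzero[of 0 0] by (metis abs_ge_zero order_trans zero_le_mult_iff abs_le_zero_iff)

lemma G_contracts: "\<bar>G k s - G k t\<bar> \<le> \<alpha> * \<bar>s - t\<bar>"
  using field_differentiable_bound[of UNIV "G k" "G' k" \<alpha> s t] DERIV_G G'_le by simp

text \<open>
  The fixed point of \<open>C \<mapsto> \<alpha> * C + \<Delta>\<close>: precomposing with a branch multiplies the logarithmic
  Lipschitz constant by \<open>\<alpha>\<close>, and the weight of the branch adds \<open>\<Delta>\<close> to it.
\<close>

abbreviation C\<^sub>0 :: real where "C\<^sub>0 \<equiv> \<Delta> / (1 - \<alpha>)"

lemma C\<^sub>0_nonneg: "0 \<le> C\<^sub>0"
  using \<Delta>_nonneg \<alpha>_less_1 by simp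

lemma log_lipschitz_transfer_op:
  assumes "log_lipschitz C\<^sub>0 (\<lambda>t. f (to_circle t))"
  shows "log_lipschitz C\<^sub>0 (\<lambda>t. transfer_op T f (to_circle t))"
proof -
  have w: "log_lipschitz \<Delta> (\<lambda>t. \<bar>G' k t\<bar>)" for k
    using DERIV_weight distortion by (intro log_lipschitz_of_deriv[of _ "W k"]) (simp_all add: G'_nonzero)
  have "\<Delta> / (1 - \<alpha>) * \<alpha> + \<Delta> = C\<^sub>0"
    using \<alpha>_less_1 by (simp add: field_simps)
  then have "log_lipschitz C\<^sub>0 (\<lambda>t. f (to_circle (G k t)) * \<bar>G' k t\<bar>)" for k
    using log_lipschitz_mult[OF log_lipschitz_compose[OF assms C\<^sub>0_nonneg G_contracts] w] by metis
  then show ?thesis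
    unfolding transfer_op_to_circle by (intro log_lipschitz_sum)
qed

lemma log_lipschitz_cesaro: "log_lipschitz C\<^sub>0 (\<lambda>t. cesaro_density T n (to_circle t))"
proof -
  have "log_lipschitz C\<^sub>0 (\<lambda>t. (transfer_op T ^^ i) (\<lambda>_. 1) (to_circle t))" for i
    by (induction i) (simp_all add: log_lipschitz_const C\<^sub>0_nonneg log_lipschitz_transfer_op del: times_divide_eq_left)
  then show ?thesis
    unfolding cesaro_density_def by (intro log_lipschitz_divide log_lipschitz_sum) simp_all
qed

end

section \<open>Differentiability of invariant functions\<close>

text \<open>
  Differentiability up to a slack \<open>r\<close>: near \<open>x\<close> the error of the linear approximation with slope
  \<open>D\<close> is at most slightly more than \<open>r * \<bar>y - x\<bar>\<close>. The case \<open>r = 0\<close> is differentiability. The calculus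
  rules below show how the slack is transformed.
\<close>

definition approx_deriv :: "(real \<Rightarrow> real) \<Rightarrow> real \<Rightarrow> real \<Rightarrow> real \<Rightarrow> bool" where
  "approx_deriv f x D r \<longleftrightarrow>
     (\<forall>e>r. \<forall>\<^sub>F y in nhds x. \<bar>f y - f x - D * (y - x)\<bar> \<le> e * \<bar>y - x\<bar>)"

lemma approx_derivD:
  "approx_deriv f x D r \<Longrightarrow> r < e \<Longrightarrow>
     \<forall>\<^sub>F y in nhds x. \<bar>f y - f x - D * (y - x)\<bar> \<le> e * \<bar>y - x\<bar>"
  by (simp add: approx_deriv_def)

lemma has_real_derivative_iff_approx_deriv:
  "(f has_real_derivative D) (at x) \<longleftrightarrow> approx_deriv f x D 0"
  unfolding has_field_derivative_def has_derivative_at_alt approx_deriv_def eventually_nhds_metric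
  by (auto simp: dist_real_def bounded_linear_mult_right)

lemma ex_small_margin:
  fixes \<phi> :: "real \<Rightarrow> real"
  assumes "isCont \<phi> 0" "\<phi> 0 < e"
  obtains \<eta> where "0 < \<eta>" "\<phi> \<eta> < e"
proof -
  have "(\<phi> \<longlongrightarrow> \<phi> 0) (at_right 0)"
    using assms(1) unfolding isCont_def by (rule tendsto_within_subset) simp
  then have "\<forall>\<^sub>F \<eta> in at_right 0. \<phi> \<eta> < e"
    using assms(2) by (rule order_tendstoD)
  moreover have "\<forall>\<^sub>F \<eta>::real in at_right 0. 0 < \<eta>"
    by (rule eventually_at_right_less)
  ultimately have "\<forall>\<^sub>F \<eta> in at_right 0. 0 < \<eta> \<and> \<phi> \<eta> < e"
    by eventually_elim simp
  then show thesis
    using that eventually_happens[of _ "at_right (0::real)"] by auto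
qed

lemma approx_deriv_zero: "approx_deriv (\<lambda>_. 0) x 0 0"
  by (simp add: approx_deriv_def)

lemma approx_deriv_add:
  assumes f: "approx_deriv f x D r" and g: "approx_deriv g x E q"
  shows "approx_deriv (\<lambda>y. f y + g y) x (D + E) (r + q)"
  unfolding approx_deriv_def
proof (intro allI impI)
  fix e assume "r + q < e"
  define c where "c = (e - r - q) / 2"
  have "0 < c" "e = (r + c) + (q + c)"
    using \<open>r + q < e\<close> by (simp_all add: c_def field_simps)
  have "\<forall>\<^sub>F y in nhds x. \<bar>f y - f x - D * (y - x)\<bar> \<le> (r + c) * \<bar>y - x\<bar>"
    "\<forall>\<^sub>F y in nhds x. \<bar>g y - g x - E * (y - x)\<bar> \<le> (q + c) * \<bar>y - x\<bar>"
    using approx_derivD[OF f] approx_derivD[OF g] \<open>0 < c\<close> by simp_all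
  then show "\<forall>\<^sub>F y in nhds x. \<bar>f y + g y - (f x + g x) - (D + E) * (y - x)\<bar> \<le> e * \<bar>y - x\<bar>"
  proof eventually_elim
    case (elim y)
    then show ?case
      unfolding \<open>e = _\<close> distrib_right by linarith
  qed
qed

lemma approx_deriv_sum:
  assumes "finite I" "\<And>i. i \<in> I \<Longrightarrow> approx_deriv (f i) x (D i) (r i)"
  shows "approx_deriv (\<lambda>y. \<Sum>i\<in>I. f i y) x (\<Sum>i\<in>I. D i) (\<Sum>i\<in>I. r i)"
  using assms by (induction I) (simp_all add: approx_deriv_zero approx_deriv_add)

lemma approx_deriv_mono: "approx_deriv f x D r \<Longrightarrow> r \<le> q \<Longrightarrow> approx_deriv f x D q"
  by (auto simp: approx_deriv_def)

lemma approx_deriv_compose: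
  assumes f: "approx_deriv f (g x) D r" and g: "(g has_real_derivative g') (at x)" and "0 \<le> r"
  shows "approx_deriv (\<lambda>y. f (g y)) x (D * g') (r * \<bar>g'\<bar>)"
  unfolding approx_deriv_def
proof (intro allI impI)
  fix e assume e: "r * \<bar>g'\<bar> < e"
  obtain \<eta> where \<eta>: "0 < \<eta>" "(r + \<eta>) * (\<bar>g'\<bar> + \<eta>) + \<bar>D\<bar> * \<eta> < e"
    by (rule ex_small_margin[of "\<lambda>\<eta>. (r + \<eta>) * (\<bar>g'\<bar> + \<eta>) + \<bar>D\<bar> * \<eta>" e])
       (use e in \<open>auto intro!: continuous_intros\<close>)
  have "filterlim g (nhds (g x)) (nhds x)"
    using DERIV_isCont[OF g] by (simp only: isCont_def tendsto_at_iff_tendsto_nhds)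
  then have "\<forall>\<^sub>F y in nhds x. \<bar>f (g y) - f (g x) - D * (g y - g x)\<bar> \<le> (r + \<eta>) * \<bar>g y - g x\<bar>"
    using approx_derivD[OF f, of "r + \<eta>"] \<eta>(1) by (auto intro: eventually_compose_filterlim)
  moreover have "\<forall>\<^sub>F y in nhds x. \<bar>g y - g x - g' * (y - x)\<bar> \<le> \<eta> * \<bar>y - x\<bar>"
    using g \<eta>(1) by (simp add: has_real_derivative_iff_approx_deriv approx_derivD)
  ultimately show "\<forall>\<^sub>F y in nhds x. \<bar>f (g y) - f (g x) - D * g' * (y - x)\<bar> \<le> e * \<bar>y - x\<bar>"
  proof eventually_elim
    case (elim y)
    define a where "a = g y - g x - g' * (y - x)"
    have "\<bar>g y - g x\<bar> \<le> \<bar>a\<bar> + \<bar>g' * (y - x)\<bar>"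
      unfolding a_def by linarith
    then have g_diff: "\<bar>g y - g x\<bar> \<le> (\<bar>g'\<bar> + \<eta>) * \<bar>y - x\<bar>"
      using elim(2) unfolding a_def[symmetric] by (simp add: abs_mult distrib_right)
    have "f (g y) - f (g x) - D * g' * (y - x) = (f (g y) - f (g x) - D * (g y - g x)) + D * a"
      by (simp add: a_def right_diff_distrib)
    then have "\<bar>f (g y) - f (g x) - D * g' * (y - x)\<bar> \<le>
        (r + \<eta>) * \<bar>g y - g x\<bar> + \<bar>D\<bar> * \<bar>a\<bar>"
      using elim(1) unfolding abs_mult[symmetric] by linarith
    also have "\<dots> \<le> (r + \<eta>) * ((\<bar>g'\<bar> + \<eta>) * \<bar>y - x\<bar>) + \<bar>D\<bar> * (\<eta> * \<bar>y - x\<bar>)"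
      using elim(2) g_diff \<eta>(1) \<open>0 \<le> r\<close> unfolding a_def[symmetric]
      by (intro add_mono mult_left_mono) auto
    also have "\<dots> = ((r + \<eta>) * (\<bar>g'\<bar> + \<eta>) + \<bar>D\<bar> * \<eta>) * \<bar>y - x\<bar>"
      by (simp add: algebra_simps)
    also have "\<dots> \<le> e * \<bar>y - x\<bar>"
      using \<eta>(2) by (intro mult_right_mono) auto
    finally show ?case .
  qed
qed

lemma approx_deriv_mult:
  assumes f: "approx_deriv f x D r" and w: "(w has_real_derivative W) (at x)" and "0 \<le> r"
  shows "approx_deriv (\<lambda>y. f y * w y) x (D * w x + f x * W) (r * \<bar>w x\<bar>)"
  unfolding approx_deriv_def
proof (intro allI impI)
  fix e assume e: "r * \<bar>w x\<bar> < e"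
  obtain \<eta> where \<eta>: "0 < \<eta>" "(r + \<eta>) * (\<bar>w x\<bar> + \<eta>) + \<bar>D\<bar> * \<eta> + \<bar>f x\<bar> * \<eta> < e"
    by (rule ex_small_margin[of "\<lambda>\<eta>. (r + \<eta>) * (\<bar>w x\<bar> + \<eta>) + \<bar>D\<bar> * \<eta> + \<bar>f x\<bar> * \<eta>" e])
       (use e in \<open>auto intro!: continuous_intros\<close>)
  have "(w \<longlongrightarrow> w x) (nhds x)"
    using DERIV_isCont[OF w] by (simp only: isCont_def tendsto_at_iff_tendsto_nhds)
  then have "\<forall>\<^sub>F y in nhds x. \<bar>w y - w x\<bar> < \<eta>"
    unfolding tendsto_iff dist_real_def using \<eta>(1) by blast
  moreover have "\<forall>\<^sub>F y in nhds x. \<bar>f y - f x - D * (y - x)\<bar> \<le> (r + \<eta>) * \<bar>y - x\<bar>"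
    using f \<eta>(1) by (simp add: approx_derivD)
  moreover have "\<forall>\<^sub>F y in nhds x. \<bar>w y - w x - W * (y - x)\<bar> \<le> \<eta> * \<bar>y - x\<bar>"
    using w \<eta>(1) by (simp add: has_real_derivative_iff_approx_deriv approx_derivD)
  ultimately show
    "\<forall>\<^sub>F y in nhds x. \<bar>f y * w y - f x * w x - (D * w x + f x * W) * (y - x)\<bar> \<le> e * \<bar>y - x\<bar>"
  proof eventually_elim
    case (elim y)
    have "f y * w y - f x * w x - (D * w x + f x * W) * (y - x) =
        (f y - f x - D * (y - x)) * w y + D * (w y - w x) * (y - x)
          + f x * (w y - w x - W * (y - x))"
      by (simp add: algebra_simps)
    also have "\<bar>\<dots>\<bar> \<le> \<bar>f y - f x - D * (y - x)\<bar> * \<bar>w y\<bar> + \<bar>D\<bar> * \<bar>w y - w x\<bar> * \<bar>y - x\<bar>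
          + \<bar>f x\<bar> * \<bar>w y - w x - W * (y - x)\<bar>"
      unfolding abs_mult[symmetric] by linarith
    also have "\<dots> \<le> ((r + \<eta>) * \<bar>y - x\<bar>) * (\<bar>w x\<bar> + \<eta>) + \<bar>D\<bar> * \<eta> * \<bar>y - x\<bar>
          + \<bar>f x\<bar> * (\<eta> * \<bar>y - x\<bar>)"
      using elim \<eta>(1) \<open>0 \<le> r\<close>
      by (intro add_mono mult_mono mult_left_mono mult_right_mono) auto
    also have "\<dots> = ((r + \<eta>) * (\<bar>w x\<bar> + \<eta>) + \<bar>D\<bar> * \<eta> + \<bar>f x\<bar> * \<eta>) * \<bar>y - x\<bar>"
      by (simp add: algebra_simps)
    also have "\<dots> \<le> e * \<bar>y - x\<bar>"
      using \<eta>(2) by (intro mult_right_mono) auto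
    finally show ?case .
  qed
qed

lemma approx_deriv_diff_le:
  assumes f: "approx_deriv f x D r" and g: "approx_deriv f x E q"
  shows "\<bar>D - E\<bar> \<le> r + q"
proof (rule field_le_epsilon)
  fix c :: real assume "0 < c"
  then have "\<forall>\<^sub>F y in nhds x. \<bar>f y - f x - D * (y - x)\<bar> \<le> (r + c / 2) * \<bar>y - x\<bar>"
    "\<forall>\<^sub>F y in nhds x. \<bar>f y - f x - E * (y - x)\<bar> \<le> (q + c / 2) * \<bar>y - x\<bar>"
    using approx_derivD[OF f] approx_derivD[OF g] by simp_all
  then have "\<forall>\<^sub>F y in nhds x. \<bar>D - E\<bar> * \<bar>y - x\<bar> \<le> (r + q + c) * \<bar>y - x\<bar>"
  proof eventually_elim
    case (elim y)
    have "\<bar>(D - E) * (y - x)\<bar> \<le> (r + c / 2) * \<bar>y - x\<bar> + (q + c / 2) * \<bar>y - x\<bar>"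
      using elim unfolding left_diff_distrib by linarith
    then show ?case
      by (simp add: abs_mult distrib_right)
  qed
  then have "\<forall>\<^sub>F y in at x. \<bar>D - E\<bar> * \<bar>y - x\<bar> \<le> (r + q + c) * \<bar>y - x\<bar> \<and> y \<noteq> x"
    unfolding eventually_at_filter by eventually_elim simp
  then have "\<exists>y. \<bar>D - E\<bar> * \<bar>y - x\<bar> \<le> (r + q + c) * \<bar>y - x\<bar> \<and> y \<noteq> x"
    by (rule eventually_happens'[OF at_neq_bot])
  then obtain y where "\<bar>D - E\<bar> * \<bar>y - x\<bar> \<le> (r + q + c) * \<bar>y - x\<bar>" "y \<noteq> x"
    by blast
  then show "\<bar>D - E\<bar> \<le> r + q + c"
    by simp
qed

text \<open>
  Two slopes with slacks \<open>r\<close> and \<open>q\<close> differ by at most \<open>r + q\<close>, so slopes whose slacks tend to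
  zero form a Cauchy sequence. Its limit is the derivative.
\<close>

lemma ex_derivative_if_approx_deriv:
  assumes "\<And>r. 0 < r \<Longrightarrow> \<exists>D. approx_deriv f x D r"
  obtains D where "(f has_real_derivative D) (at x)"
proof -
  define r where "r n = inverse (real (Suc n))" for n
  have r_lim: "r \<longlonglongrightarrow> 0" and r_pos: "0 < r n" for n
    unfolding r_def[abs_def] by (rule LIMSEQ_inverse_real_of_nat) simp
  have "\<forall>n. \<exists>D. approx_deriv f x D (r n)"
    using assms r_pos by blast
  then obtain D where D: "\<And>n. approx_deriv f x (D n) (r n)"
    by metis
  have "Cauchy D"
  proof (rule metric_CauchyI)
    fix e :: real assume "0 < e"
    then have "\<forall>\<^sub>F n in sequentially. r n < e / 2"
      using order_tendstoD(2)[OF r_lim, of "e / 2"] by simp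
    then obtain N where N: "\<And>n. n \<ge> N \<Longrightarrow> r n < e / 2"
      by (auto simp: eventually_sequentially)
    have "dist (D m) (D n) < e" if "m \<ge> N" "n \<ge> N" for m n
      using approx_deriv_diff_le[OF D[of m] D[of n]] N[OF that(1)] N[OF that(2)]
      by (simp add: dist_real_def)
    then show "\<exists>N. \<forall>m\<ge>N. \<forall>n\<ge>N. dist (D m) (D n) < e" by blast
  qed
  then obtain L where L: "D \<longlonglongrightarrow> L"
    using Cauchy_convergent_iff convergent_def by metis
  have "approx_deriv f x L 0"
    unfolding approx_deriv_def
  proof (intro allI impI)
    fix e :: real assume "0 < e"
    then have "\<forall>\<^sub>F n in sequentially. r n < e / 2" "\<forall>\<^sub>F n in sequentially. \<bar>D n - L\<bar> < e / 2"
      using order_tendstoD(2)[OF r_lim, of "e / 2"] tendstoD[OF L, of "e / 2"]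
      by (simp_all add: dist_real_def)
    then have "\<forall>\<^sub>F n in sequentially. r n < e / 2 \<and> \<bar>D n - L\<bar> < e / 2"
      by eventually_elim simp
    then obtain n where n: "r n < e / 2" "\<bar>D n - L\<bar> < e / 2"
      using eventually_happens[of _ sequentially] by auto
    have "\<forall>\<^sub>F y in nhds x. \<bar>f y - f x - D n * (y - x)\<bar> \<le> e / 2 * \<bar>y - x\<bar>"
      using approx_derivD[OF D n(1)] .
    then show "\<forall>\<^sub>F y in nhds x. \<bar>f y - f x - L * (y - x)\<bar> \<le> e * \<bar>y - x\<bar>"
    proof eventually_elim
      case (elim y)
      have "\<bar>(D n - L) * (y - x)\<bar> \<le> e / 2 * \<bar>y - x\<bar>"
        unfolding abs_mult using n(2) by (intro mult_right_mono) auto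
      with elim show ?case
        unfolding left_diff_distrib by linarith
    qed
  qed
  then show thesis
    using that by (simp add: has_real_derivative_iff_approx_deriv)
qed

lemma log_lipschitz_approx_deriv:
  assumes f: "log_lipschitz C f" and "0 \<le> C"
  shows "approx_deriv f x 0 (C * f x)"
  unfolding approx_deriv_def
proof (intro allI impI)
  fix e assume e: "C * f x < e"
  have "((\<lambda>h. exp (C * h) * f x) has_real_derivative C * f x) (at 0)"
    by (auto intro!: derivative_eq_intros)
  then have "\<forall>\<^sub>F h in nhds 0. \<bar>exp (C * h) * f x - f x - C * f x * h\<bar> \<le> (e - C * f x) * \<bar>h\<bar>"
    using e approx_derivD[of "\<lambda>h. exp (C * h) * f x" 0 "C * f x" 0 "e - C * f x"]
    by (simp add: has_real_derivative_iff_approx_deriv)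
  moreover have "filterlim (\<lambda>y. \<bar>y - x\<bar>) (nhds 0) (nhds x)"
    by (auto intro!: tendsto_eq_intros filterlim_ident)
  ultimately have "\<forall>\<^sub>F y in nhds x.
      \<bar>exp (C * \<bar>y - x\<bar>) * f x - f x - C * f x * \<bar>y - x\<bar>\<bar> \<le> (e - C * f x) * \<bar>\<bar>y - x\<bar>\<bar>"
    by (rule eventually_compose_filterlim)
  then show "\<forall>\<^sub>F y in nhds x. \<bar>f y - f x - 0 * (y - x)\<bar> \<le> e * \<bar>y - x\<bar>"
  proof eventually_elim
    case (elim y)
    then have "exp (C * \<bar>y - x\<bar>) * f x - f x \<le> e * \<bar>y - x\<bar>"
      by (simp add: algebra_simps abs_le_iff)
    then show ?case
      using log_lipschitz_diff_le[OF assms, of y x] by simp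
  qed
qed

lemma log_lipschitz_deriv_le:
  assumes f: "log_lipschitz C f" "0 \<le> C" and "(f has_real_derivative D) (at x)"
  shows "\<bar>D\<bar> \<le> C * f x"
  using approx_deriv_diff_le[of f x D 0 0 "C * f x"] log_lipschitz_approx_deriv[OF f]
    assms(3) by (simp add: has_real_derivative_iff_approx_deriv)

context inverse_branches
begin

text \<open>
  In the sum for \<open>v\<close> the slack of the term of branch \<open>k\<close> gets one factor \<open>\<bar>G' k x\<bar>\<close> from the
  inner function and another one from the weight. The first is at most \<open>\<alpha>\<close>; with the second the
  terms add up to \<open>v x\<close> again. Measuring the slack relative to \<open>v\<close> itself is what makes this a
  contraction by \<open>\<alpha>\<close>, since the weights alone need not add up to one.
\<close>

lemma approx_deriv_improve:
  assumes inv: "\<And>x. v x = (\<Sum>k\<in>J. v (G k x) * \<bar>G' k x\<bar>)"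
    and nonneg: "\<And>x. 0 \<le> v x" and "0 \<le> M"
    and v: "\<And>x. \<exists>D. approx_deriv v x D (M * v x)"
  shows "\<exists>D. approx_deriv v x D (\<alpha> * M * v x)"
proof -
  obtain D where D: "\<And>x. approx_deriv v x (D x) (M * v x)"
    using v by metis
  define r where "r k = M * v (G k x) * \<bar>G' k x\<bar> * \<bar>\<bar>G' k x\<bar>\<bar>" for k
  have "approx_deriv (\<lambda>y. v (G k y) * \<bar>G' k y\<bar>) x
      (D (G k x) * G' k x * \<bar>G' k x\<bar> + v (G k x) * W k x) (r k)" for k
    unfolding r_def using nonneg \<open>0 \<le> M\<close>
    by (intro approx_deriv_mult approx_deriv_compose D DERIV_G DERIV_weight) auto
  from approx_deriv_sum[OF finite_J, of "\<lambda>k y. v (G k y) * \<bar>G' k y\<bar>", OF this]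
  have "\<exists>E. approx_deriv (\<lambda>y. \<Sum>k\<in>J. v (G k y) * \<bar>G' k y\<bar>) x E (\<Sum>k\<in>J. r k)"
    by blast
  then have "\<exists>E. approx_deriv v x E (\<Sum>k\<in>J. r k)"
    by (simp flip: inv)
  moreover have "(\<Sum>k\<in>J. r k) \<le> (\<Sum>k\<in>J. M * v (G k x) * \<bar>G' k x\<bar> * \<alpha>)"
    unfolding r_def using nonneg \<open>0 \<le> M\<close> by (intro sum_mono mult_left_mono) (auto simp: G'_le)
  then have "(\<Sum>k\<in>J. r k) \<le> \<alpha> * M * v x"
    by (subst inv) (simp add: sum_distrib_left mult_ac)
  ultimately show ?thesis
    using approx_deriv_mono by blast
qed

lemma invariant_differentiable:
  assumes v: "log_lipschitz C v" "0 \<le> C"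
    and inv: "\<And>x. v x = (\<Sum>k\<in>J. v (G k x) * \<bar>G' k x\<bar>)"
  obtains D where "(v has_real_derivative D) (at x)"
proof -
  have "\<exists>D. approx_deriv v x D (\<alpha> ^ n * C * v x)" for n x
  proof (induction n arbitrary: x)
    case 0
    then show ?case
      using log_lipschitz_approx_deriv[OF v] by auto
  next
    case (Suc n)
    then show ?case
      using approx_deriv_improve[OF inv log_lipschitz_nonneg[OF v(1)], of "\<alpha> ^ n * C" x] \<open>0 \<le> C\<close> \<alpha>_nonneg
      by (simp add: mult.assoc)
  qed
  moreover have "(\<lambda>n. \<alpha> ^ n * C * v x) \<longlonglongrightarrow> 0"
    using \<alpha>_nonneg \<alpha>_less_1 by (intro tendsto_mult_left_zero LIMSEQ_power_zero) auto
  then have "\<exists>n. \<alpha> ^ n * C * v x < r" if "0 < r" for r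
    using that order_tendstoD(2) eventually_happens[of _ sequentially] by fastforce
  ultimately have "\<exists>D. approx_deriv v x D r" if "0 < r" for r
    using that approx_deriv_mono less_imp_le by metis
  then show thesis
    using ex_derivative_if_approx_deriv that by blast
qed

end

section \<open>Almost everywhere statements on the circle\<close>

lemma measurable_to_circle: "to_circle \<in> measurable (restrict_space lborel {0..<1}) borel"
  by (intro measurable_restrict_space1) 
     (simp add: borel_measurable_continuous_onI continuous_to_circle)

lemma space_circle_measure [simp]: "space circle_measure = UNIV"
  by (simp add: circle_measure_def)

text \<open>
  Almost everywhere on the circle means almost everywhere on \<open>[0,1)\<close>; the rest of the line
  is covered by countably many translates.
\<close>

lemma AE_circle_measure_imp_AE_lborel:
  assumes "AE x in circle_measure. P x"
  shows "AE t in lborel. P (to_circle t)"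
proof -
  have "AE t in restrict_space lborel {0..<1::real}. P (to_circle t)"
    using AE_distrD[OF measurable_to_circle] assms unfolding circle_measure_def .
  then have unit: "AE t in lborel. t \<in> {0..<1} \<longrightarrow> P (to_circle t)"
    by (simp add: AE_restrict_space_iff)
  have "AE t in lborel. of_int k + t \<in> {0..<1} \<longrightarrow> P (to_circle (of_int k + t))" for k :: int
    by (rule AE_distrD[of "(+) (of_int k)" lborel borel]) (simp, simp only: lborel_distr_plus unit)
  then have "AE t in lborel. \<forall>k::int. of_int k + t \<in> {0..<1} \<longrightarrow> P (to_circle (of_int k + t))"
    by (simp add: AE_all_countable)
  then show ?thesis
  proof eventually_elim
    case (elim t)
    have "of_int (- \<lfloor>t\<rfloor>) + t = frac t"
      by (simp add: frac_def)
    with elim[rule_format, of "- \<lfloor>t\<rfloor>"] show ?case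
      using frac_lt_1[of t] frac_ge_0[of t] by (simp del: of_int_minus)
  qed
qed

lemma borel_measurable_circle:
  fixes f :: "circle \<Rightarrow> real"
  assumes "continuous_on UNIV (\<lambda>t. f (to_circle t))"
  shows "f \<in> borel_measurable circle_measure"
proof -
  have "open (f -` U)" if "open U" for U
    using continuous_open_preimage[OF assms open_UNIV that]
    by (simp add: open_circle_def vimage_def)
  then have "continuous_on UNIV f"
    by (simp add: continuous_on_open_vimage)
  then show ?thesis
    by (simp add: circle_measure_def borel_measurable_continuous_onI)
qed

lemma integrable_circle:
  fixes f :: "circle \<Rightarrow> real"
  assumes "continuous_on UNIV (\<lambda>t. f (to_circle t))"
  shows "integrable circle_measure f"
proof -
  have "continuous_on UNIV (\<lambda>t. \<bar>f (to_circle t)\<bar>)"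
    by (intro continuous_intros assms)
  then obtain z where "\<And>x. \<bar>f x\<bar> \<le> \<bar>f z\<bar>"
    using circle_attains_sup[of "\<lambda>x. \<bar>f x\<bar>"] by blast
  then show ?thesis
    by (intro finite_measure.integrable_const_bound[OF prob_space_circle_measure(1), of _ "\<bar>f z\<bar>"]
        borel_measurable_circle assms) auto
qed

lemma (in inverse_branches) AE_branch:
  assumes "AE t in lborel. P t"
  shows "AE t in lborel. P (G k t)"
proof -
  obtain N where N: "N \<in> null_sets lborel" "{t \<in> space lborel. \<not> P t} \<subseteq> N"
    using assms unfolding eventually_ae_filter by blast
  have "negligible N"
    using N(1) by (simp add: negligible_iff_null_sets null_sets_completionI)
  then have "negligible {t \<in> UNIV. G k t \<in> N}"
    by (rule negligible_differentiable_vimage[where f' = "\<lambda>x. (*) (G' k x)"])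
       (use DERIV_G G'_nonzero in \<open>auto simp: has_field_derivative_def intro!: injI\<close>)
  then have "{t. G k t \<in> N} \<in> null_sets (completion lborel)"
    by (simp add: negligible_iff_null_sets)
  then have "AE t in completion lborel. P (G k t)"
    by (rule AE_I') (use N(2) in auto)
  then show ?thesis
    by (simp add: AE_completion_iff)
qed

lemma lipschitz_imp_W11:
  assumes lip: "\<And>s t. \<bar>f (to_circle s) - f (to_circle t)\<bar> \<le> K * \<bar>s - t\<bar>"
  shows "f \<in> W11"
  unfolding W11_def
proof (intro CollectI allI impI)
  fix \<epsilon> :: real assume "0 < \<epsilon>"
  have "0 \<le> K"
    using lip[of 1 0] by simp
  show "\<exists>\<delta>>0. \<forall>(n::nat) a b. (\<forall>i<n. 0 \<le> a i \<and> a i \<le> b i \<and> b i \<le> 1) \<longrightarrow>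
      disjoint_family_on (\<lambda>i. {a i<..<b i}) {..<n} \<longrightarrow> (\<Sum>i<n. b i - a i) < \<delta> \<longrightarrow>
      (\<Sum>i<n. \<bar>f (to_circle (b i)) - f (to_circle (a i))\<bar>) < \<epsilon>"
  proof (intro exI[of _ "\<epsilon> / (K + 1)"] conjI allI impI)
    fix n :: nat and a b :: "nat \<Rightarrow> real"
    assume ab: "\<forall>i<n. 0 \<le> a i \<and> a i \<le> b i \<and> b i \<le> 1"
      and small: "(\<Sum>i<n. b i - a i) < \<epsilon> / (K + 1)"
    have nonneg: "0 \<le> (\<Sum>i<n. b i - a i)"
      using ab by (intro sum_nonneg) auto
    have "(\<Sum>i<n. \<bar>f (to_circle (b i)) - f (to_circle (a i))\<bar>) \<le> (\<Sum>i<n. K * (b i - a i))"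
      using ab lip by (intro sum_mono) (metis abs_of_nonneg diff_ge_0_iff_ge lessThan_iff)
    also have "\<dots> \<le> (K + 1) * (\<Sum>i<n. b i - a i)"
      using nonneg by (simp add: sum_distrib_left[symmetric] distrib_right)
    also have "\<dots> < \<epsilon>"
      using small \<open>0 \<le> K\<close> by (simp add: less_divide_eq mult.commute)
    finally show "(\<Sum>i<n. \<bar>f (to_circle (b i)) - f (to_circle (a i))\<bar>) < \<epsilon>" .
  qed (use \<open>0 < \<epsilon>\<close> \<open>0 \<le> K\<close> in simp)
qed

section \<open>The invariant density\<close>

context inverse_branches
begin

text \<open>
  Convergence in \<open>L\<^sup>1\<close> gives convergence almost everywhere along a subsequence, and the
  averages all lie in the cone with the constant \<open>C\<^sub>0\<close>.
\<close>

lemma cesaro_limit_representative: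
  assumes h: "integrable circle_measure h"
    and lim: "(\<lambda>k. L1_norm (\<lambda>x. cesaro_density T (r k) x - h x)) \<longlonglongrightarrow> 0"
  obtains u where "log_lipschitz C\<^sub>0 (\<lambda>t. u (to_circle t))" "AE x in circle_measure. u x = h x"
proof -
  have "integrable circle_measure (cesaro_density T n)" for n
    by (intro integrable_circle log_lipschitz_continuous[OF log_lipschitz_cesaro C\<^sub>0_nonneg])
  then have "\<And>k. integrable circle_measure (\<lambda>x. cesaro_density T (r k) x - h x)"
    using h by simp
  from tendsto_L1_AE_subseq[of circle_measure "\<lambda>k x. cesaro_density T (r k) x - h x", OF this] lim
  obtain q where q: "AE x in circle_measure. (\<lambda>k. cesaro_density T (r (q k)) x - h x) \<longlonglongrightarrow> 0"
    unfolding L1_norm_def real_norm_def by blast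
  define S where "S = {x. (\<lambda>k. cesaro_density T (r (q k)) x) \<longlonglongrightarrow> h x}"
  have S: "AE x in circle_measure. x \<in> S"
    using q by (simp add: S_def LIM_zero_iff)
  have "ae_filter circle_measure \<noteq> bot"
    using prob_space_circle_measure(2) by (simp add: ae_filter_eq_bot_iff)
  then have "S \<noteq> {}"
    using eventually_happens[OF S] by auto
  then obtain u where u: "log_lipschitz C\<^sub>0 (\<lambda>t. u (to_circle t))" "\<And>x. x \<in> S \<Longrightarrow> u x = h x"
    using log_lipschitz_limit_extends[of C\<^sub>0 "\<lambda>k. cesaro_density T (r (q k))" S h]
      log_lipschitz_cesaro C\<^sub>0_nonneg by (auto simp: S_def)
  moreover have "AE x in circle_measure. u x = h x"
    using S by eventually_elim (rule u(2))
  ultimately show thesis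
    using that by blast
qed

text \<open>
  Preimages of null sets under the branches are null, so \<open>transfer_op T u\<close> and \<open>u\<close> agree almost
  everywhere. Both are continuous, hence they agree everywhere, as the pointwise argument for
  differentiability requires.
\<close>

lemma representative_invariant:
  assumes u: "log_lipschitz C\<^sub>0 (\<lambda>t. u (to_circle t))"
    and eq: "AE x in circle_measure. u x = h x"
    and inv: "AE x in circle_measure. transfer_op T h x = h x"
  shows "transfer_op T u x = u x"
proof -
  have eq': "AE t in lborel. u (to_circle t) = h (to_circle t)"
    and inv': "AE t in lborel. transfer_op T h (to_circle t) = h (to_circle t)"
    using eq inv by (auto dest: AE_circle_measure_imp_AE_lborel)
  have "AE t in lborel. \<forall>k\<in>J. u (to_circle (G k t)) = h (to_circle (G k t))"
    using AE_branch[OF eq'] finite_J by (simp add: AE_finite_all)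
  with eq' inv' have "AE t in lborel. transfer_op T u (to_circle t) = u (to_circle t)"
    by eventually_elim (simp add: transfer_op_to_circle)
  then have "AE t in lebesgue. t \<in> {t. transfer_op T u (to_circle t) = u (to_circle t)}"
    by (simp add: AE_completion_iff)
  moreover have "closed {t. transfer_op T u (to_circle t) = u (to_circle t)}"
    using u log_lipschitz_transfer_op[OF u]
    by (intro closed_Collect_eq log_lipschitz_continuous[OF _ C\<^sub>0_nonneg])
  ultimately have "transfer_op T u (to_circle t) = u (to_circle t)" for t
    using mem_closed_if_AE_lebesgue by blast
  then show ?thesis
    using surj_to_circle by metis
qed

text \<open>
  The function is differentiable with \<open>\<bar>u'\<bar> \<le> C\<^sub>0 * u\<close>. Integration gives the bound on the norm of the
  derivative, and boundedness of \<open>u\<close> shows that \<open>u\<close> is Lipschitz.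
\<close>

lemma invariant_W11:
  assumes u: "log_lipschitz C\<^sub>0 (\<lambda>t. u (to_circle t))"
    and inv: "\<And>x. transfer_op T u x = u x"
  shows "u \<in> W11" and "L1_norm (fun_deriv u) \<le> C\<^sub>0 * (\<integral>x. u x \<partial>circle_measure)"
proof -
  have "\<exists>D. ((\<lambda>t. u (to_circle t)) has_real_derivative D) (at t)" for t
    using invariant_differentiable[OF u C\<^sub>0_nonneg]
    by (metis inv transfer_op_to_circle)
  then obtain D where D: "\<And>t. ((\<lambda>t. u (to_circle t)) has_real_derivative D t) (at t)"
    by metis
  have D_le: "\<bar>D t\<bar> \<le> C\<^sub>0 * u (to_circle t)" for t
    using log_lipschitz_deriv_le[OF u C\<^sub>0_nonneg D] .
  have cont: "continuous_on UNIV (\<lambda>t. u (to_circle t))"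
    by (rule log_lipschitz_continuous[OF u C\<^sub>0_nonneg])
  then obtain z where z: "\<And>x. u x \<le> u z"
    using circle_attains_sup by blast
  have "\<bar>u (to_circle s) - u (to_circle t)\<bar> \<le> (C\<^sub>0 * u z) * \<bar>s - t\<bar>" for s t
  proof -
    have "\<bar>D t\<bar> \<le> C\<^sub>0 * u z" for t
      using D_le[of t] mult_left_mono[OF z C\<^sub>0_nonneg] by (rule order_trans)
    then show ?thesis
      using field_differentiable_bound[of UNIV "\<lambda>t. u (to_circle t)" D "C\<^sub>0 * u z" s t] D by simp
  qed
  then show "u \<in> W11"
    by (rule lipschitz_imp_W11)
  have u_nonneg: "0 \<le> u x" for x
    using log_lipschitz_nonneg[OF u] surj_to_circle by metis
  have "\<bar>fun_deriv u x\<bar> \<le> C\<^sub>0 * u x" for x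
    using surj_to_circle[of x] fun_deriv_to_circle_eq[OF D] D_le by metis
  then have "(\<integral>x. \<bar>fun_deriv u x\<bar> \<partial>circle_measure) \<le> (\<integral>x. C\<^sub>0 * u x \<partial>circle_measure)"
    by (intro integral_mono' integrable_mult_right integrable_circle cont
        mult_nonneg_nonneg C\<^sub>0_nonneg u_nonneg) auto
  then show "L1_norm (fun_deriv u) \<le> C\<^sub>0 * (\<integral>x. u x \<partial>circle_measure)"
    by (simp add: L1_norm_def)
qed

end

theorem proposition13:
  fixes T :: "circle \<Rightarrow> circle" and h :: "circle \<Rightarrow> real" and r :: "nat \<Rightarrow> nat" and \<alpha> :: real
  assumes "expanding_map T"
    and "\<alpha> = (SUP x. 1 / \<bar>circle_deriv T x\<bar>)"
    and "invariant_density T h"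
    and "strict_mono r"
    and "(\<lambda>k. L1_norm (\<lambda>x. cesaro_density T (r k) x - h x)) \<longlonglongrightarrow> 0"
  shows "\<exists>u \<in> W11. (AE x in circle_measure. u x = h x) \<and>
           W11_norm u \<le>
             (sup_norm (\<lambda>x. fun_deriv (circle_deriv T) x / (circle_deriv T x)\<^sup>2) + 1) / (1 - \<alpha>)"
proof -
  define \<Delta> where "\<Delta> = sup_norm (\<lambda>x. fun_deriv (circle_deriv T) x / (circle_deriv T x)\<^sup>2)"
  obtain J G G' W where "inverse_branches T J G G' W \<alpha> \<Delta>"
    using expanding_map_inverse_branches[OF assms(1)] unfolding assms(2) \<Delta>_def by blast
  then interpret inverse_branches T J G G' W \<alpha> \<Delta> .
  have h: "integrable circle_measure h" "(\<integral>x. h x \<partial>circle_measure) = 1"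
    "AE x in circle_measure. transfer_op T h x = h x"
    using assms(3) by (auto simp: invariant_density_def)
  obtain u where u: "log_lipschitz C\<^sub>0 (\<lambda>t. u (to_circle t))"
    and eq: "AE x in circle_measure. u x = h x"
    using cesaro_limit_representative[OF h(1) assms(5)] by blast
  have inv: "transfer_op T u x = u x" for x
    using representative_invariant[OF u eq h(3)] .
  have "(\<integral>x. u x \<partial>circle_measure) = (\<integral>x. h x \<partial>circle_measure)"
    using borel_measurable_circle[OF log_lipschitz_continuous[OF u C\<^sub>0_nonneg]] h(1) eq
    by (intro integral_cong_AE) auto
  then have int_u: "(\<integral>x. u x \<partial>circle_measure) = 1"
    using h(2) by simp
  have "\<bar>u x\<bar> = u x" for x
    using log_lipschitz_nonneg[OF u] surj_to_circle[of x] by auto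
  then have "L1_norm u = 1"
    using int_u by (simp add: L1_norm_def)
  then have "W11_norm u \<le> 1 + C\<^sub>0"
    using invariant_W11(2)[OF u inv] int_u by (simp add: W11_norm_def)
  also have "\<dots> = (\<Delta> + 1 - \<alpha>) / (1 - \<alpha>)"
    using \<alpha>_less_1 by (simp add: field_simps)
  also have "\<dots> \<le> (\<Delta> + 1) / (1 - \<alpha>)"
    using \<alpha>_nonneg \<alpha>_less_1 by (intro divide_right_mono) auto
  finally show ?thesis
    using invariant_W11(1)[OF u inv] eq unfolding \<Delta>_def by blast
qed

end
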